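(* Let $\mathcal{F}$ be the $k$-vector space with basis $a,b,c,d$ and the two coassociative coproducts $$\Delta a=a\otimes a+b\otimes c,\quad \Delta b=a\otimes b+b\otimes d,\quad \Delta c=d\otimes c+c\otimes a,\quad \Delta d=d\otimes d+c\otimes b,$$ $$\tilde\Delta a=b\otimes a+a\otimes c,\quad \tilde\Delta b=b\otimes b+a\otimes d,\quad \tilde\Delta c=c\otimes c+d\otimes a,\quad \tilde\Delta d=c\otimes d+d\otimes b.$$ The geometric supports of $(\mathcal{F},\tilde\Delta)$ and $(\mathcal{F},\Delta)$ (with respect to the basis $a,b,c,d$), glued together, yield the $(4,1)$-De Bruijn graph. Moreover the intersection of their arrow sets is empty.
   Context: The field $k$ is $\mathbb{R}$ or $\mathbb{C}$. The geometric support of a coalgebra $(L,\Delta)$ with chosen basis $L_0$ is the directed graph with vertex set $L_0$ and arrow set the set of tensors $u\otimes v$ ($u,v\in L_0$) appearing with nonzero coefficient in the coproducts of basis elements; $u\otimes v$ is viewed as an arrow from $u$ to $v$. Gluing two graphs with the same vertex set means taking the union of the arrow sets. The $(4,1)$-De Bruijn graph is the directed graph with four vertices having exactly one arrow from $u$ to $v$ for every ordered pair of vertices $(u,v)$ (including loops). *)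

theory Defs
  imports "HOL-Analysis.Analysis" "Graph_Theory.Digraph_Component"
begin

text \<open>
  A finite-dimensional \<open>k\<close>-vector space is modelled by \<open>'k ^ 'n\<close>, and the tensor product of
  \<open>'k ^ 'n\<close> and \<open>'k ^ 'm\<close> by \<open>'k ^ ('n \<times> 'm)\<close>, with the following bilinear map as the universal one.
  The class \<open>real_normed_field\<close> expresses that the scalar field is the reals or the complex
  numbers: by the Gelfand--Mazur theorem these are its only instances up to isomorphism.
\<close>

definition tensor :: "'k::field ^ 'n \<Rightarrow> 'k ^ 'm \<Rightarrow> 'k ^ ('n \<times> 'm)" (infixr "\<otimes>" 75)
  where "u \<otimes> v = (\<chi> p. u $ fst p * v $ snd p)"

text \<open>
  For linear \<open>f\<close> and \<open>g\<close> this is the linear map \<open>f \<otimes> g\<close>, given by its values on the tensors of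
  standard unit vectors.
\<close>

definition tensor_map ::
    "('k::field ^ 'n \<Rightarrow> 'k ^ 'p) \<Rightarrow> ('k ^ 'm \<Rightarrow> 'k ^ 'q) \<Rightarrow> 'k ^ ('n \<times> 'm) \<Rightarrow> 'k ^ ('p \<times> 'q)"
  where "tensor_map f g t =
    (\<Sum>i\<in>UNIV. \<Sum>j\<in>UNIV. t $ (i, j) *s (f (axis i 1) \<otimes> g (axis j 1)))"

text \<open>The canonical isomorphism from \<open>(U \<otimes> V) \<otimes> W\<close> to \<open>U \<otimes> (V \<otimes> W)\<close>.\<close>

definition tensor_assoc :: "'k::field ^ (('n::finite \<times> 'm::finite) \<times> 'p::finite) \<Rightarrow> 'k ^ ('n \<times> 'm \<times> 'p)"
  where "tensor_assoc t = (\<chi> p. case p of (i, j, l) \<Rightarrow> t $ ((i, j), l))"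

definition coassociative :: "('k::field ^ 'n \<Rightarrow> 'k ^ ('n \<times> 'n)) \<Rightarrow> bool"
  where "coassociative \<Delta> \<longleftrightarrow>
    (\<forall>x. tensor_assoc (tensor_map \<Delta> id (\<Delta> x)) = tensor_map id \<Delta> (\<Delta> x))"

definition tensor_basis :: "('k::field ^ 'n) set \<Rightarrow> ('k ^ ('n \<times> 'n)) set"
  where "tensor_basis L0 = (\<lambda>(u, v). u \<otimes> v) ` (L0 \<times> L0)"

text \<open>
  The arrows are the tensors \<open>u \<otimes> v\<close> themselves. When \<open>L0\<close> is a basis, \<open>(u, v) \<mapsto> u \<otimes> v\<close> is
  injective on \<open>L0 \<times> L0\<close>, so that tail and head recover \<open>u\<close> and \<open>v\<close>; moreover
  \<open>tensor_basis L0\<close> is then a basis, so that \<open>vec.representation\<close> yields the coefficients with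
  respect to it.
\<close>

definition geometric_support ::
    "('k::field ^ 'n) set \<Rightarrow> ('k ^ 'n \<Rightarrow> 'k ^ ('n \<times> 'n)) \<Rightarrow> ('k ^ 'n, 'k ^ ('n \<times> 'n)) pre_digraph"
  where "geometric_support L0 \<Delta> =
    \<lparr> verts = L0,
      arcs = {u \<otimes> v | u v. u \<in> L0 \<and> v \<in> L0 \<and>
        (\<exists>w\<in>L0. vec.representation (tensor_basis L0) (\<Delta> w) (u \<otimes> v) \<noteq> 0)},
      tail = (\<lambda>t. fst (the_inv_into (L0 \<times> L0) (\<lambda>(u, v). u \<otimes> v) t)),
      head = (\<lambda>t. snd (the_inv_into (L0 \<times> L0) (\<lambda>(u, v). u \<otimes> v) t)) \<rparr>"

text \<open>
  The \<open>(n, 1)\<close>-De Bruijn graph, characterised up to isomorphism (vertices and arrows may have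
  arbitrary names).
\<close>

definition is_De_Bruijn_1 :: "nat \<Rightarrow> ('a, 'b) pre_digraph \<Rightarrow> bool"
  where "is_De_Bruijn_1 n G \<longleftrightarrow>
    wf_digraph G \<and> finite (verts G) \<and> card (verts G) = n \<and>
    (\<forall>u\<in>verts G. \<forall>v\<in>verts G. \<exists>!e. e \<in> arcs G \<and> tail G e = u \<and> head G e = v)"

end

theory Submission
  imports Defs
begin

text \<open>
  Write \<open>B\<close> for the basis \<open>{a, b, c, d}\<close>. The sixteen pairs in \<open>B \<times> B\<close> are distributed over the two
  coproducts without repetition: each coproduct is a sum of eight tensors \<open>u \<otimes> v\<close>, two for each basis
  element, and no pair \<open>(u, v)\<close> is used twice. All graph-theoretic claims follow from this partition,
  provided that pairs \<open>(u, v)\<close>, tensors \<open>u \<otimes> v\<close> and arrows may be identified.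

  This identification is linear algebra: for independent \<open>B\<close> the tensors \<open>u \<otimes> v\<close> are pairwise
  different (\<open>tensor_inj_on\<close>) and independent (\<open>tensor_basis_independent\<close>). Hence the coefficients of
  a coproduct are those in which it is written (\<open>arcs_geometric_support\<close>), and the arrows from \<open>u\<close>
  to \<open>v\<close> in a geometric support are at most the single tensor \<open>u \<otimes> v\<close>, which makes a union of two
  supports that contains every \<open>u \<otimes> v\<close> a De Bruijn graph (\<open>is_De_Bruijn_1_union_geometric_support\<close>).

  Coassociativity is a computation with triple tensors. It may be done on basis elements only
  (\<open>coassociative_if_on_generators\<close>), where \<open>(f \<otimes> g) (u \<otimes> v) = f u \<otimes> g v\<close> (\<open>tensor_map_tensor\<close>)
  reduces both sides to sums of four tensors of basis elements that agree up to order. For instance,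
  both sides for \<open>\<Delta>\<close> at \<open>a\<close> are the sum of \<open>a \<otimes> a \<otimes> a\<close>, \<open>a \<otimes> b \<otimes> c\<close>, \<open>b \<otimes> c \<otimes> a\<close> and
  \<open>b \<otimes> d \<otimes> c\<close>.
\<close>

section \<open>Tensor products of linear maps\<close>

lemma tensor_add_left: "(u + v) \<otimes> w = u \<otimes> w + v \<otimes> w"
  by (simp add: tensor_def vec_eq_iff algebra_simps)

lemma tensor_add_right: "u \<otimes> (v + w) = u \<otimes> v + u \<otimes> w"
  by (simp add: tensor_def vec_eq_iff algebra_simps)

lemma tensor_assoc_add: "tensor_assoc (s + t) = tensor_assoc s + tensor_assoc t"
  by (auto simp: tensor_assoc_def vec_eq_iff)

lemma tensor_assoc_tensor: "tensor_assoc ((u \<otimes> v) \<otimes> w) = u \<otimes> v \<otimes> w"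
  by (auto simp: tensor_assoc_def tensor_def vec_eq_iff mult.assoc)

lemma linear_tensor_assoc:
  "Vector_Spaces.linear (*s) (*s)
    (tensor_assoc :: 'k::field ^ (('n::finite \<times> 'm::finite) \<times> 'p::finite) \<Rightarrow> 'k ^ ('n \<times> 'm \<times> 'p))"
  unfolding Vector_Spaces.linear_iff
  by (intro conjI allI vec.vector_space_axioms) (auto simp: tensor_assoc_def vec_eq_iff)

lemma linear_tensor_map: "Vector_Spaces.linear (*s) (*s) (tensor_map f g)"
  unfolding Vector_Spaces.linear_iff
  by (intro conjI allI vec.vector_space_axioms)
    (simp_all add: tensor_map_def vec_eq_iff sum.distrib sum_distrib_left algebra_simps)

lemma tensor_map_add: "tensor_map f g (s + t) = tensor_map f g s + tensor_map f g t"
  by (rule vec.linear_add[OF linear_tensor_map])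

text \<open>
  The map \<^term>\<open>tensor_map f g\<close> is prescribed on tensors of standard unit vectors only; expanding
  \<open>u\<close> and \<open>v\<close> in the standard basis extends the prescription to all pure tensors.
\<close>

lemma tensor_map_tensor:
  fixes f :: "'k::field ^ 'n \<Rightarrow> 'k ^ 'p" and g :: "'k ^ 'm \<Rightarrow> 'k ^ 'q"
  assumes "Vector_Spaces.linear (*s) (*s) f" "Vector_Spaces.linear (*s) (*s) g"
  shows "tensor_map f g (u \<otimes> v) = f u \<otimes> g v"
proof -
  have expand: "h x $ l = (\<Sum>i\<in>UNIV. x $ i * h (axis i 1) $ l)"
    if "Vector_Spaces.linear (*s) (*s) h" for h :: "'k ^ 'x \<Rightarrow> 'k ^ 'y" and x l
  proof -
    have "h x = h (\<Sum>i\<in>UNIV. x $ i *s axis i 1)"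
      by (simp only: basis_expansion)
    also have "\<dots> = (\<Sum>i\<in>UNIV. x $ i *s h (axis i 1))"
      by (simp add: vec.linear_sum[OF that] vec.linear_scale[OF that])
    finally show ?thesis
      by simp
  qed
  show ?thesis
    by (simp add: vec_eq_iff tensor_map_def tensor_def expand[OF assms(1), of u]
        expand[OF assms(2), of v] sum_product mult.assoc mult.left_commute)
qed

text \<open>Both sides of the coassociativity law are linear, so it need only be checked on generators.\<close>

lemma coassociative_if_on_generators:
  fixes \<Delta> :: "'k::field ^ 'n \<Rightarrow> 'k ^ ('n \<times> 'n)"
  assumes \<Delta>: "Vector_Spaces.linear (*s) (*s) \<Delta>" and B: "vec.span B = UNIV"
    and eq: "\<And>x. x \<in> B \<Longrightarrow> tensor_assoc (tensor_map \<Delta> id (\<Delta> x)) = tensor_map id \<Delta> (\<Delta> x)"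
  shows "coassociative \<Delta>"
proof -
  have l: "Vector_Spaces.linear (*s) (*s) (\<lambda>x. tensor_assoc (tensor_map \<Delta> id (\<Delta> x)))"
    using Vector_Spaces.linear_compose[OF Vector_Spaces.linear_compose[OF \<Delta> linear_tensor_map]
        linear_tensor_assoc]
    by (simp add: o_def)
  have r: "Vector_Spaces.linear (*s) (*s) (\<lambda>x. tensor_map id \<Delta> (\<Delta> x))"
    using Vector_Spaces.linear_compose[OF \<Delta> linear_tensor_map] by (simp add: o_def)
  show ?thesis
    unfolding coassociative_def
    using vec.linear_eq_on_span[OF l r eq] B by blast
qed

section \<open>The tensor basis\<close>

text \<open>
  Taking the \<open>i\<close>-th coordinate of the first factor in a relation \<open>\<Sum> c (u, v) u \<otimes> v = 0\<close> gives a
  linear relation among the \<open>v\<close>, hence \<open>\<Sum>u. c (u, v) u $ i = 0\<close> for every \<open>v\<close>. As this holds for all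
  \<open>i\<close>, it is a linear relation among the \<open>u\<close>.
\<close>

lemma tensor_family_independent:
  fixes B :: "('k::field ^ 'n) set"
  assumes B: "vec.independent B" and uv: "u \<in> B" "v \<in> B"
    and zero: "(\<Sum>p\<in>B \<times> B. c p *s (fst p \<otimes> snd p)) = 0"
  shows "c (u, v) = 0"
proof -
  have fin: "finite B"
    by (rule vec.finiteI_independent[OF B])
  have "(\<Sum>v\<in>B. (\<Sum>u\<in>B. c (u, v) * u $ i) *s v) = 0" for i
  proof (simp add: vec_eq_iff, intro allI)
    fix j
    have "(\<Sum>v\<in>B. (\<Sum>u\<in>B. c (u, v) * u $ i) * v $ j) =
        (\<Sum>u\<in>B. \<Sum>v\<in>B. c (u, v) * (u $ i * v $ j))"
      by (subst sum.swap) (simp add: sum_distrib_right mult.assoc)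
    also have "\<dots> = (\<Sum>p\<in>B \<times> B. c p *s (fst p \<otimes> snd p)) $ (i, j)"
      by (simp add: sum.cartesian_product tensor_def case_prod_unfold)
    finally show "(\<Sum>v\<in>B. (\<Sum>u\<in>B. c (u, v) * u $ i) * v $ j) = 0"
      by (simp add: zero)
  qed
  then have "(\<Sum>u\<in>B. c (u, v) * u $ i) = 0" for i
    by (rule vec.independentD[where u = "\<lambda>v. \<Sum>u\<in>B. c (u, v) * u $ i" and t = B,
          OF B fin subset_refl _ uv(2)])
  then have "(\<Sum>u\<in>B. c (u, v) *s u) = 0"
    by (simp add: vec_eq_iff)
  then show ?thesis
    by (rule vec.independentD[where u = "\<lambda>u. c (u, v)" and t = B, OF B fin subset_refl _ uv(1)])
qed

text \<open>
  If two different pairs had the same tensor, then giving them the coefficients \<open>1\<close> and \<open>-1\<close> would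
  violate the independence of the family.
\<close>

lemma tensor_inj_on:
  fixes B :: "('k::field ^ 'n) set"
  assumes B: "vec.independent B"
  shows "inj_on (\<lambda>(u, v). u \<otimes> v) (B \<times> B)"
proof (rule inj_onI, rule ccontr)
  fix p q
  assume p: "p \<in> B \<times> B" and q: "q \<in> B \<times> B" and neq: "p \<noteq> q"
    and eq: "(\<lambda>(u, v). u \<otimes> v) p = (\<lambda>(u, v). u \<otimes> v) q"
  define c :: "_ \<Rightarrow> 'k" where "c = (\<lambda>r. if r = p then 1 else if r = q then - 1 else 0)"
  have fin: "finite (B \<times> B)"
    by (intro finite_cartesian_product vec.finiteI_independent[OF B])
  have "(\<Sum>r\<in>B \<times> B. c r *s (fst r \<otimes> snd r)) = (\<Sum>r\<in>{p, q}. c r *s (fst r \<otimes> snd r))"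
    using p q by (intro sum.mono_neutral_right fin) (auto simp: c_def)
  also have "\<dots> = 0"
    using neq eq by (simp add: c_def case_prod_unfold)
  finally have "c (fst p, snd p) = 0"
    using p by (intro tensor_family_independent[OF B]) auto
  then show False
    by (simp add: c_def)
qed

lemma tensor_basis_independent:
  fixes B :: "('k::field ^ 'n) set"
  assumes B: "vec.independent B"
  shows "vec.independent (tensor_basis B)"
proof -
  have fin: "finite (B \<times> B)"
    by (intro finite_cartesian_product vec.finiteI_independent[OF B])
  have "c t = 0" if zero: "(\<Sum>t\<in>tensor_basis B. c t *s t) = 0" and t: "t \<in> tensor_basis B" for c t
  proof -
    have "(\<Sum>p\<in>B \<times> B. c (fst p \<otimes> snd p) *s (fst p \<otimes> snd p)) = 0"
      using zero unfolding tensor_basis_def sum.reindex[OF tensor_inj_on[OF B]]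
      by (simp add: case_prod_unfold)
    from tensor_family_independent[where c = "\<lambda>p. c (fst p \<otimes> snd p)", OF B _ _ this]
    have "c (u \<otimes> v) = 0" if "u \<in> B" "v \<in> B" for u v
      using that by simp
    then show ?thesis
      using t by (auto simp: tensor_basis_def)
  qed
  then show ?thesis
    using fin by (auto simp: vec.independent_explicit tensor_basis_def)
qed

section \<open>Geometric supports\<close>

text \<open>
  The coefficients with respect to the tensor basis are unique, so the arrows can be read off from
  any expansion of the coproducts as multiplicity-free sums of tensors of basis elements.
\<close>

lemma arcs_geometric_support:
  fixes B :: "('k::field ^ 'n) set"
  assumes B: "vec.independent B"
    and S: "\<And>w. w \<in> B \<Longrightarrow> S w \<subseteq> B \<times> B"
    and \<Delta>: "\<And>w. w \<in> B \<Longrightarrow> \<Delta> w = (\<Sum>(u, v)\<in>S w. u \<otimes> v)"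
  shows "arcs (geometric_support B \<Delta>) = (\<lambda>(u, v). u \<otimes> v) ` (\<Union>w\<in>B. S w)"
proof -
  have coeff: "vec.representation (tensor_basis B) (\<Delta> w) (u \<otimes> v) = (if (u, v) \<in> S w then 1 else 0)"
    if w: "w \<in> B" and u: "u \<in> B" and v: "v \<in> B" for u v w
  proof -
    have fin: "finite (S w)"
      by (intro finite_subset[OF S[OF w]] finite_cartesian_product vec.finiteI_independent[OF B])
    have mem: "fst p \<otimes> snd p \<in> tensor_basis B" if "p \<in> S w" for p
      using S[OF w] that by (force simp: tensor_basis_def)
    have "vec.representation (tensor_basis B) (\<Delta> w) (u \<otimes> v) =
        (\<Sum>p\<in>S w. if u \<otimes> v = fst p \<otimes> snd p then 1 else 0)"
      using mem
      by (simp add: \<Delta>[OF w] case_prod_unfold vec.span_base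
          vec.representation_sum[OF tensor_basis_independent[OF B]]
          vec.representation_basis[OF tensor_basis_independent[OF B]])
    also have "\<dots> = (\<Sum>p\<in>S w. if (u, v) = p then 1 else 0)"
    proof (rule sum.cong[OF refl])
      fix p assume "p \<in> S w"
      then have "p \<in> B \<times> B"
        using S[OF w] by blast
      then have "u \<otimes> v = fst p \<otimes> snd p \<longleftrightarrow> (u, v) = p"
        using inj_on_eq_iff[OF tensor_inj_on[OF B], of "(u, v)" p] u v
        by (simp add: case_prod_unfold)
      then show "(if u \<otimes> v = fst p \<otimes> snd p then 1 else 0) = (if (u, v) = p then 1 else (0::'k))"
        by simp
    qed
    finally show ?thesis
      using fin by simp
  qed
  show ?thesis
  proof (intro set_eqI iffI)
    fix t assume "t \<in> arcs (geometric_support B \<Delta>)"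
    then obtain u v w where "t = u \<otimes> v" "u \<in> B" "v \<in> B" "w \<in> B"
      and "vec.representation (tensor_basis B) (\<Delta> w) (u \<otimes> v) \<noteq> 0"
      by (auto simp: geometric_support_def)
    then show "t \<in> (\<lambda>(u, v). u \<otimes> v) ` (\<Union>w\<in>B. S w)"
      by (force simp: coeff split: if_splits)
  next
    fix t assume "t \<in> (\<lambda>(u, v). u \<otimes> v) ` (\<Union>w\<in>B. S w)"
    then obtain u v w where t: "t = u \<otimes> v" and w: "w \<in> B" and uv: "(u, v) \<in> S w"
      by auto
    have u: "u \<in> B" and v: "v \<in> B"
      using S[OF w] uv by auto
    have "vec.representation (tensor_basis B) (\<Delta> w) (u \<otimes> v) \<noteq> 0"
      by (simp add: coeff[OF w u v] uv)
    then show "t \<in> arcs (geometric_support B \<Delta>)"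
      using t u v w unfolding geometric_support_def pre_digraph.select_convs by blast
  qed
qed

text \<open>
  Since \<open>(u, v) \<mapsto> u \<otimes> v\<close> is injective on pairs of basis elements, \<open>u \<otimes> v\<close> is the only tensor that
  can be an arrow from \<open>u\<close> to \<open>v\<close>. The tail and head maps do not depend on the coproduct, so gluing
  only merges the arrow sets.
\<close>

lemma is_De_Bruijn_1_union_geometric_support:
  fixes B :: "('k::field ^ 'n) set"
  assumes B: "vec.independent B"
    and arcs: "arcs (geometric_support B \<Delta>\<^sub>1) \<union> arcs (geometric_support B \<Delta>\<^sub>2) = tensor_basis B"
  shows "is_De_Bruijn_1 (card B)
    (Digraph_Component.union (geometric_support B \<Delta>\<^sub>1) (geometric_support B \<Delta>\<^sub>2))"
    (is "is_De_Bruijn_1 _ ?G")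
proof -
  have ends: "tail ?G (u \<otimes> v) = u" "head ?G (u \<otimes> v) = v" if "u \<in> B" "v \<in> B" for u v
    using the_inv_into_f_f[OF tensor_inj_on[OF B], of "(u, v)"] that
    by (simp_all add: geometric_support_def)
  have verts: "verts ?G = B"
    by (simp add: geometric_support_def)
  have arcs': "arcs ?G = tensor_basis B"
    using arcs by simp
  have "wf_digraph ?G"
    unfolding wf_digraph_def verts arcs'
    by (auto simp: ends tensor_basis_def simp del: tail_union head_union)
  moreover have "finite B"
    by (rule vec.finiteI_independent[OF B])
  moreover have "\<exists>!e. e \<in> tensor_basis B \<and> tail ?G e = u \<and> head ?G e = v"
    if "u \<in> B" "v \<in> B" for u v
    using that by (intro ex1I[of _ "u \<otimes> v"])
      (auto simp: ends tensor_basis_def simp del: tail_union head_union)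
  ultimately show ?thesis
    unfolding is_De_Bruijn_1_def verts arcs' by blast
qed

section \<open>The two coproducts\<close>

theorem theorem3p3:
  fixes a b c d :: "'k::real_normed_field ^ 'n"
    and \<Delta> \<Delta>' :: "'k ^ 'n \<Rightarrow> 'k ^ ('n \<times> 'n)"
  assumes basis: "distinct [a, b, c, d]"
      "vec.independent {a, b, c, d}"
      "vec.span {a, b, c, d} = UNIV"
    and \<Delta>: "Vector_Spaces.linear (*s) (*s) \<Delta>"
      "\<Delta> a = a \<otimes> a + b \<otimes> c"
      "\<Delta> b = a \<otimes> b + b \<otimes> d"
      "\<Delta> c = d \<otimes> c + c \<otimes> a"
      "\<Delta> d = d \<otimes> d + c \<otimes> b"
    and \<Delta>': "Vector_Spaces.linear (*s) (*s) \<Delta>'"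
      "\<Delta>' a = b \<otimes> a + a \<otimes> c"
      "\<Delta>' b = b \<otimes> b + a \<otimes> d"
      "\<Delta>' c = c \<otimes> c + d \<otimes> a"
      "\<Delta>' d = c \<otimes> d + d \<otimes> b"
  shows "coassociative \<Delta> \<and> coassociative \<Delta>' \<and>
    is_De_Bruijn_1 4
      (Digraph_Component.union (geometric_support {a, b, c, d} \<Delta>') (geometric_support {a, b, c, d} \<Delta>)) \<and>
    arcs (geometric_support {a, b, c, d} \<Delta>') \<inter> arcs (geometric_support {a, b, c, d} \<Delta>) = {}"
proof -
  let ?B = "{a, b, c, d}"
  have distinct: "a \<noteq> b" "a \<noteq> c" "a \<noteq> d" "b \<noteq> c" "b \<noteq> d" "c \<noteq> d"
      "b \<noteq> a" "c \<noteq> a" "d \<noteq> a" "c \<noteq> b" "d \<noteq> b" "d \<noteq> c"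
    using basis(1) by auto
  \<comment> \<open>the pairs that occur in the coproduct of a basis element; the values outside \<open>?B\<close> are arbitrary\<close>
  define S where "S = (\<lambda>w. if w = a then {(a, a), (b, c)} else if w = b then {(a, b), (b, d)}
    else if w = c then {(d, c), (c, a)} else {(d, d), (c, b)})"
  define S' where "S' = (\<lambda>w. if w = a then {(b, a), (a, c)} else if w = b then {(b, b), (a, d)}
    else if w = c then {(c, c), (d, a)} else {(c, d), (d, b)})"
  note tensor_simps = tensor_map_add tensor_map_tensor tensor_assoc_add tensor_assoc_tensor
    tensor_add_left tensor_add_right vec.linear_id add_ac
  have coassoc: "coassociative \<Delta>"
    by (rule coassociative_if_on_generators[OF \<Delta>(1) basis(3)]) (auto simp: \<Delta> tensor_simps)
  have coassoc': "coassociative \<Delta>'"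
    by (rule coassociative_if_on_generators[OF \<Delta>'(1) basis(3)]) (auto simp: \<Delta>' tensor_simps)
  have S: "S a = {(a, a), (b, c)}" "S b = {(a, b), (b, d)}"
      "S c = {(d, c), (c, a)}" "S d = {(d, d), (c, b)}"
    using distinct by (simp_all add: S_def)
  have S': "S' a = {(b, a), (a, c)}" "S' b = {(b, b), (a, d)}"
      "S' c = {(c, c), (d, a)}" "S' d = {(c, d), (d, b)}"
    using distinct by (simp_all add: S'_def)
  have "\<Delta> w = (\<Sum>(u, v)\<in>S w. u \<otimes> v)" if "w \<in> ?B" for w
    using that by (elim insertE emptyE) (use distinct in \<open>simp_all add: S \<Delta>\<close>)
  moreover have "S w \<subseteq> ?B \<times> ?B" if "w \<in> ?B" for w
    using that by (elim insertE emptyE) (simp_all add: S)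
  ultimately have arcs: "arcs (geometric_support ?B \<Delta>) = (\<lambda>(u, v). u \<otimes> v) ` (\<Union>w\<in>?B. S w)"
    by (intro arcs_geometric_support[OF basis(2)])
  have "\<Delta>' w = (\<Sum>(u, v)\<in>S' w. u \<otimes> v)" if "w \<in> ?B" for w
    using that by (elim insertE emptyE) (use distinct in \<open>simp_all add: S' \<Delta>'\<close>)
  moreover have "S' w \<subseteq> ?B \<times> ?B" if "w \<in> ?B" for w
    using that by (elim insertE emptyE) (simp_all add: S')
  ultimately have arcs': "arcs (geometric_support ?B \<Delta>') = (\<lambda>(u, v). u \<otimes> v) ` (\<Union>w\<in>?B. S' w)"
    by (intro arcs_geometric_support[OF basis(2)])
  have cover: "(\<Union>w\<in>?B. S' w) \<union> (\<Union>w\<in>?B. S w) = ?B \<times> ?B"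
    by (auto simp: S S')
  have "(\<Union>w\<in>?B. S' w) \<inter> (\<Union>w\<in>?B. S w) = {}"
    using distinct by (simp add: S S')
  then have disjoint: "arcs (geometric_support ?B \<Delta>') \<inter> arcs (geometric_support ?B \<Delta>) = {}"
    unfolding arcs arcs' using cover
    by (subst inj_on_image_Int[OF tensor_inj_on[OF basis(2)], symmetric])
      (blast | simp only: image_empty)+
  have "is_De_Bruijn_1 (card ?B)
      (Digraph_Component.union (geometric_support ?B \<Delta>') (geometric_support ?B \<Delta>))"
    by (rule is_De_Bruijn_1_union_geometric_support[OF basis(2)])
      (simp only: arcs arcs' tensor_basis_def cover flip: image_Un)
  moreover have "card ?B = 4"
    using distinct by simp
  ultimately show ?thesis
    using coassoc coassoc' disjoint by simp
qed

end
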